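(* There is no $3$-by-$40$ shorthand universal torus for the permutations of $\{0,1,2,3,4\}$ with $2$-by-$2$ windows.
   Context: A $3$-by-$40$ shorthand universal torus for the permutations of $\{0,1,2,3,4\}$ with $2$-by-$2$ windows is an array $T : \mathbb{Z}_3 \times \mathbb{Z}_{40} \to \{0,1,2,3,4\}$ (row indices modulo $3$, column indices modulo $40$) such that every word of length $4$ with pairwise distinct entries in $\{0,1,2,3,4\}$ is equal to the row-major reading $T(i,j)\,T(i,j+1)\,T(i+1,j)\,T(i+1,j+1)$ for exactly one position $(i,j)\in \mathbb{Z}_3\times\mathbb{Z}_{40}$. (Each such word encodes a permutation of five symbols by appending its missing symbol.) *)

theory Defs
  imports Main
begin

text \<open>
  An \<open>r\<close>-by-\<open>c\<close> array on the torus is a function on indices \<open>i < r\<close>, \<open>j < c\<close>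
  (canonical representatives of the residues modulo \<open>r\<close> and \<open>c\<close>); values outside this range
  are never inspected.
\<close>

definition window :: "nat \<Rightarrow> nat \<Rightarrow> (nat \<Rightarrow> nat \<Rightarrow> nat) \<Rightarrow> nat \<Rightarrow> nat \<Rightarrow> nat list" where
  "window r c T i j =
     [T i j, T i ((j + 1) mod c), T ((i + 1) mod r) j, T ((i + 1) mod r) ((j + 1) mod c)]"

definition shorthand_words :: "nat list set" where
  "shorthand_words = {w. length w = 4 \<and> distinct w \<and> set w \<subseteq> {0, 1, 2, 3, 4}}"

definition shorthand_universal_torus :: "nat \<Rightarrow> nat \<Rightarrow> (nat \<Rightarrow> nat \<Rightarrow> nat) \<Rightarrow> bool" where
  "shorthand_universal_torus r c T \<longleftrightarrow>
     (\<forall>i<r. \<forall>j<c. T i j \<in> {0, 1, 2, 3, 4}) \<and>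
     (\<forall>w\<in>shorthand_words.
        \<exists>!p. p \<in> {..<r} \<times> {..<c} \<and> window r c T (fst p) (snd p) = w)"

end

theory Submission
  imports Defs
begin

text \<open>
  There are as many words as positions, so every window is a permutation word. With three
  rows any two rows are cyclically adjacent, so any two cells in two neighbouring columns lie in a
  common window; the six entries of two such columns would be distinct, but there are only five
  symbols.
\<close>

lemma card_shorthand_words: "card shorthand_words = 120"
proof -
  have "card shorthand_words = \<Prod>{card {0, 1, 2, 3, 4 :: nat} - 4 + 1..card {0, 1, 2, 3, 4 :: nat}}"
    unfolding shorthand_words_def by (rule card_lists_distinct_length_eq) simp_all
  also have "{card {0, 1, 2, 3, 4 :: nat} - 4 + 1..card {0, 1, 2, 3, 4 :: nat}} = {2, 3, 4, 5}"
    by auto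
  finally show ?thesis
    by simp
qed

text \<open>Each word is the window at some position, so the image of the 120 positions under
  \<open>?f\<close> contains all 120 words. It has at most 120 elements, hence nothing else.\<close>

lemma window_in_shorthand_words:
  assumes "shorthand_universal_torus r c T" "r * c = 120" "i < r" "j < c"
  shows "window r c T i j \<in> shorthand_words"
proof -
  let ?f = "\<lambda>p. window r c T (fst p) (snd p)" and ?P = "{..<r} \<times> {..<c}"
  have "card (?f ` ?P) \<le> card shorthand_words"
    using card_image_le[of ?P ?f] \<open>r * c = 120\<close>
    by (simp add: card_shorthand_words card_cartesian_product)
  moreover have "shorthand_words \<subseteq> ?f ` ?P"
    using assms(1) unfolding shorthand_universal_torus_def by (fast intro: image_eqI)
  ultimately have "?f ` ?P = shorthand_words"
    by (intro card_seteq[symmetric]) auto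
  moreover have "window r c T i j \<in> ?f ` ?P"
    using assms(3,4) by force
  ultimately show ?thesis
    by simp
qed

theorem theorem2:
  shows "\<not> (\<exists>T :: nat \<Rightarrow> nat \<Rightarrow> nat. shorthand_universal_torus 3 40 T)"
proof
  assume "\<exists>T :: nat \<Rightarrow> nat \<Rightarrow> nat. shorthand_universal_torus 3 40 T"
  then obtain T where T: "shorthand_universal_torus 3 40 T"
    by blast
  let ?xs = "[T 0 0, T 1 0, T 2 0, T 0 1, T 1 1, T 2 1]"
  have win: "distinct (window 3 40 T i 0)" "set (window 3 40 T i 0) \<subseteq> {0, 1, 2, 3, 4}"
    if "i < 3" for i
    using window_in_shorthand_words[OF T, of i 0] that by (simp_all add: shorthand_words_def)
  \<comment> \<open>The windows at rows 0, 1 and 2 cover the row pairs 0-1, 1-2 and, by wrap-around,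
    2-0, so any two of the six cells share a window.\<close>
  have dist: "distinct ?xs"
    using win(1)[of 0] win(1)[of 1] win(1)[of 2]
    by (auto simp: window_def numeral_2_eq_2)
  have sub: "set ?xs \<subseteq> {0, 1, 2, 3, 4}"
    using win(2)[of 0] win(2)[of 2] win(2)[of 1]
    by (simp add: window_def numeral_2_eq_2)
  have "length ?xs \<le> card {0, 1, 2, 3, 4 :: nat}"
    using card_mono[OF _ sub] distinct_card[OF dist] by simp
  then show False
    by simp
qed

end
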